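(* Let $n\ge 3$ be odd, let $k\ge 1$ be an integer, and let $r$ be an odd integer with $1\le r<n$. Let $G(n;k,r)$ be the unicyclic graph consisting of a cycle $C_n$ with vertices $a_1,a_2,\dots,a_n$ (in cyclic order), together with $k_i$ pendant vertices attached to $a_i$ for each $1\le i\le n$, where $k_r=k_{n-r}=k+1$ and $k_i=k$ for $i\notin\{r,n-r\}$ (so $G(n;k,r)$ has $p=q=n(k+1)+2$ vertices and edges). Then $G(n;k,r)$ admits a super edge-magic total labeling and $$sm(G(n;k,r))=2n(k+1)+4+\frac{n+3}{2}.$$
   Context: All graphs are finite, simple and undirected. For a graph $G$ with $p$ vertices and $q$ edges, a super edge-magic total labeling is a bijection $f\colon V(G)\cup E(G)\to\{1,2,\dots,p+q\}$ with $f(V(G))=\{1,\dots,p\}$ such that $f(u)+f(v)+f(uv)$ equals a constant $c(f)$ (the magic constant) for every edge $uv\in E(G)$. $G$ is super edge-magic total if it admits such a labeling, and its super edge-magic total strength $sm(G)$ is the minimum of $c(f)$ over all super edge-magic total labelings $f$ of $G$. *)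

theory Defs
  imports Main
begin

section \<open>Finite simple graphs\<close>

type_synonym 'a graph = "'a set \<times> 'a set set"

abbreviation verts :: "'a graph \<Rightarrow> 'a set" where
  "verts G \<equiv> fst G"

abbreviation edges :: "'a graph \<Rightarrow> 'a set set" where
  "edges G \<equiv> snd G"

definition simple_graph :: "'a graph \<Rightarrow> bool" where
  "simple_graph G \<longleftrightarrow> finite (verts G) \<and> (\<forall>e\<in>edges G. e \<subseteq> verts G \<and> card e = 2)"


section \<open>Super edge-magic total labelings and strength\<close>

text \<open>The labels of vertices and edges are the values of one function on the disjoint union
  \<open>verts G <+> edges G\<close>. The predicate takes the magic constant \<open>c\<close> as an argument; for a graph
  with at least one edge it is determined by \<open>f\<close>.\<close>

definition semt_labeling :: "'a graph \<Rightarrow> ('a + 'a set \<Rightarrow> nat) \<Rightarrow> nat \<Rightarrow> bool" where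
  "semt_labeling G f c \<longleftrightarrow>
     bij_betw f (verts G <+> edges G) {1..card (verts G) + card (edges G)} \<and>
     f ` Inl ` verts G = {1..card (verts G)} \<and>
     (\<forall>u v. {u, v} \<in> edges G \<longrightarrow> f (Inl u) + f (Inl v) + f (Inr {u, v}) = c)"

definition super_edge_magic_total :: "'a graph \<Rightarrow> bool" where
  "super_edge_magic_total G \<longleftrightarrow> (\<exists>f c. semt_labeling G f c)"

text \<open>The minimum is meaningful only if \<open>super_edge_magic_total G\<close> holds.\<close>

definition semt_strength :: "'a graph \<Rightarrow> nat" where
  "semt_strength G = (LEAST c. \<exists>f. semt_labeling G f c)"


section \<open>Cycles with pendant vertices\<close>

text \<open>The cycle vertex \<open>a\<^sub>i\<close> is \<open>(i, 0)\<close>, for \<open>1 \<le> i \<le> n\<close>; the \<open>m i\<close> pendant vertices attached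
  to it are \<open>(i, j)\<close> with \<open>1 \<le> j \<le> m i\<close>.\<close>

definition pendant_cycle :: "nat \<Rightarrow> (nat \<Rightarrow> nat) \<Rightarrow> (nat \<times> nat) graph" where
  "pendant_cycle n m =
     ({(i, j) | i j. 1 \<le> i \<and> i \<le> n \<and> j \<le> m i},
      {{(i, 0), (i + 1, 0)} | i. 1 \<le> i \<and> i < n} \<union> {{(n, 0), (1, 0)}} \<union>
      {{(i, 0), (i, j)} | i j. 1 \<le> i \<and> i \<le> n \<and> 1 \<le> j \<and> j \<le> m i})"

definition G_graph :: "nat \<Rightarrow> nat \<Rightarrow> nat \<Rightarrow> (nat \<times> nat) graph" where
  "G_graph n k r = pendant_cycle n (\<lambda>i. if i = r \<or> i = n - r then k + 1 else k)"

lemma simple_graph_pendant_cycle: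
  assumes "n \<ge> 3"
  shows "simple_graph (pendant_cycle n m)"
proof -
  have "{(i, j) | i j. 1 \<le> i \<and> i \<le> n \<and> j \<le> m i} = Sigma {1..n} (\<lambda>i. {..m i})"
    by auto
  then have "finite {(i, j) | i j. 1 \<le> i \<and> i \<le> n \<and> j \<le> m i}"
    by simp
  with assms show ?thesis
    unfolding simple_graph_def pendant_cycle_def by auto
qed

lemma card_verts_pendant_cycle: "card (verts (pendant_cycle n m)) = (\<Sum>i=1..n. m i + 1)"
proof -
  have "verts (pendant_cycle n m) = Sigma {1..n} (\<lambda>i. {..m i})"
    unfolding pendant_cycle_def by auto
  then show ?thesis by simp
qed

lemma card_edges_pendant_cycle:
  assumes "n \<ge> 3"
  shows "card (edges (pendant_cycle n m)) = (\<Sum>i=1..n. m i + 1)"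
proof -
  define h :: "nat \<times> nat \<Rightarrow> (nat \<times> nat) set" where
    "h = (\<lambda>(i, j). if j = 0 then {(i, 0), (if i = n then 1 else i + 1, 0)} else {(i, 0), (i, j)})"
  have "edges (pendant_cycle n m) = h ` Sigma {1..n} (\<lambda>i. {..m i})" (is "?L = ?R")
  proof
    show "?L \<subseteq> ?R"
    proof
      fix e assume "e \<in> ?L"
      then consider i where "1 \<le> i" "i < n" "e = {(i, 0), (i + 1, 0)}"
        | "e = {(n, 0), (1, 0)}"
        | i j where "1 \<le> i" "i \<le> n" "1 \<le> j" "j \<le> m i" "e = {(i, 0), (i, j)}"
        unfolding pendant_cycle_def by auto
      then show "e \<in> ?R"
      proof cases
        case 1 then show ?thesis by (intro image_eqI[of _ _ "(i, 0)"]) (auto simp: h_def)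
      next
        case 2 then show ?thesis using assms by (intro image_eqI[of _ _ "(n, 0)"]) (auto simp: h_def)
      next
        case 3 then show ?thesis by (intro image_eqI[of _ _ "(i, j)"]) (auto simp: h_def)
      qed
    qed
    show "?R \<subseteq> ?L"
      unfolding pendant_cycle_def h_def by (fastforce split: if_splits)
  qed
  moreover have "inj_on h (Sigma {1..n} (\<lambda>i. {..m i}))"
    using assms unfolding inj_on_def h_def
    by (auto simp: doubleton_eq_iff split: if_splits)
  ultimately show ?thesis by (simp add: card_image)
qed

lemma sum_pendants:
  fixes n k r :: nat
  assumes "odd n" and "odd r" and "1 \<le> r" and "r < n"
  shows "(\<Sum>i=1..n. (if i = r \<or> i = n - r then k + 1 else k) + 1) = n * (k + 1) + 2"
proof -
  have "r \<noteq> n - r" using assms by presburger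
  have "(\<Sum>i=1..n. (if i = r \<or> i = n - r then k + 1 else k) + 1) =
        (\<Sum>i=1..n. (k + 1) + (if i \<in> {r, n - r} then 1 else 0))"
    by (intro sum.cong) auto
  also have "\<dots> = (\<Sum>i=1..n. k + 1) + (\<Sum>i=1..n. if i \<in> {r, n - r} then 1 else 0)"
    by (rule sum.distrib)
  also have "(\<Sum>i=1..n. k + 1) = n * (k + 1)" by simp
  also have "(\<Sum>i=1..n. if i \<in> {r, n - r} then 1 else 0) = card ({1..n} \<inter> {r, n - r})"
    by (simp only: sum.inter_restrict[symmetric] finite_atLeastAtMost card_eq_sum)
  also have "{1..n} \<inter> {r, n - r} = {r, n - r}" using assms by auto
  also have "card {r, n - r} = 2" using \<open>r \<noteq> n - r\<close> by simp
  finally show ?thesis .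
qed

lemma G_graph_order_size:
  assumes "n \<ge> 3" and "odd n" and "odd r" and "1 \<le> r" and "r < n"
  shows "card (verts (G_graph n k r)) = n * (k + 1) + 2"
    and "card (edges (G_graph n k r)) = n * (k + 1) + 2"
  using sum_pendants[OF assms(2-5), of k] assms(1)
  unfolding G_graph_def by (simp_all only: card_verts_pendant_cycle card_edges_pendant_cycle)

end

theory Submission
  imports Defs
begin

text \<open>Summing \<open>f(u) + f(v) + f(uv) = c\<close> over all edges bounds \<open>c\<close> from below, because the cycle
  vertices, whose degrees exceed one, carry \<open>n\<close> distinct positive labels.

  For the upper bound let \<open>n = 2 m + 1\<close> and label the cycle by \<open>1, \<dots>, n\<close> in the classical way, so
  that the edge sums on the cycle are consecutive. A pendant vertex with label \<open>t\<close> at the cycle vertex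
  with label \<open>g\<close> gives the edge sum \<open>(m + 1) + (t + \<delta>)\<close>, where \<open>\<delta> = g - (m + 1)\<close>. Hence we need a
  permutation of the interval of pendant labels whose displacements are each \<open>\<delta> \<in> {-m, \<dots>, m}\<close> exactly
  \<open>k\<close> times, and once more \<open>d\<close> and \<open>-d\<close> for \<open>d = m + 1 - (r + 1) / 2\<close>. On a block of \<open>n\<close> labels the
  permutation \<open>t \<mapsto> 2 t mod n\<close> has each displacement once. On a block of \<open>n + 2\<close> labels the permutation
  with \<open>t \<mapsto> 2 t\<close> for \<open>t \<le> d\<close>, \<open>d + 1 \<mapsto> 1\<close>, \<open>t \<mapsto> 2 t - 2\<close> for \<open>d + 2 \<le> t \<le> m + 2\<close> and
  \<open>t \<mapsto> 2 t - (2 m + 3)\<close> for \<open>t \<ge> m + 3\<close> has the displacements \<open>-m, \<dots>, m\<close> and \<open>d, -d\<close>.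
  One block of the second kind and \<open>k - 1\<close> of the first kind give the labeling.\<close>

section \<open>Super edge-magic total labelings from vertex labelings\<close>

text \<open>Reduces the task to vertices: by counting, the edge sums fill \<open>q\<close>
  consecutive values from \<open>s\<close> on, so giving the edge of sum \<open>t\<close> the label
  \<open>p + q + s - t\<close> uses each of \<open>p + 1, ..., p + q\<close> once.\<close>

lemma semt_labeling_of_vertex_labeling:
  fixes g :: "'a \<Rightarrow> nat"
  assumes G: "simple_graph G"
    and g: "bij_betw g (verts G) {1..card (verts G)}"
    and inj: "inj_on (sum g) (edges G)"
    and range: "sum g ` edges G \<subseteq> {s..<s + card (edges G)}"
  shows "\<exists>f. semt_labeling G f (card (verts G) + card (edges G) + s)"
proof -
  define p where "p = card (verts G)"
  define q where "q = card (edges G)"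
  define f where "f = case_sum g (\<lambda>e. p + q + s - sum g e)"
  have fin: "finite (verts G)" using G by (simp add: simple_graph_def)
  have "edges G \<subseteq> Pow (verts G)" using G by (auto simp: simple_graph_def)
  with fin have finE: "finite (edges G)" by (meson finite_Pow_iff finite_subset)
  have le: "s \<le> sum g e" "sum g e < s + q" if "e \<in> edges G" for e
    using range that by (auto simp: q_def)
  have "inj_on (\<lambda>e. p + q + s - sum g e) (edges G)"
  proof (rule inj_onI)
    fix e e' assume e: "e \<in> edges G" "e' \<in> edges G"
      and eq: "p + q + s - sum g e = p + q + s - sum g e'"
    then have "sum g e = sum g e'" using le[OF e(1)] le[OF e(2)] by linarith
    with inj e show "e = e'" by (auto dest: inj_onD)
  qed
  moreover have "(\<lambda>e. p + q + s - sum g e) ` edges G \<subseteq> {p + 1..p + q}"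
    using le by force
  ultimately have fE: "bij_betw (\<lambda>e. p + q + s - sum g e) (edges G) {p + 1..p + q}"
    unfolding bij_betw_def by (simp add: card_image card_subset_eq q_def)
  have "bij_betw f (verts G <+> edges G) ({1..p} \<union> {p + 1..p + q})"
    unfolding Plus_def
  proof (rule bij_betw_combine)
    show "bij_betw f (Inl ` verts G) {1..p}"
      using g by (auto simp: bij_betw_def f_def p_def inj_on_def image_image)
    show "bij_betw f (Inr ` edges G) {p + 1..p + q}"
      using fE by (auto simp: bij_betw_def f_def inj_on_def image_image)
  qed auto
  moreover have "{1..p} \<union> {p + 1..p + q} = {1..p + q}" by auto
  moreover have "f ` Inl ` verts G = {1..p}"
    using g by (auto simp: bij_betw_def f_def p_def image_image)
  moreover have "f (Inl u) + f (Inl v) + f (Inr {u, v}) = p + q + s" if "{u, v} \<in> edges G" for u v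
  proof -
    have "card {u, v} = 2" using that G by (auto simp: simple_graph_def)
    then have "u \<noteq> v" by auto
    then show ?thesis using le[OF that] by (simp add: f_def)
  qed
  ultimately show ?thesis unfolding semt_labeling_def p_def q_def by auto
qed

section \<open>Edges of cycles with pendant vertices\<close>

text \<open>The vertex set, reused to index the edges: \<open>(i, 0)\<close> stands for the cycle
  edge leaving \<open>(i, 0)\<close>, and \<open>(i, j)\<close> with \<open>j > 0\<close> for its
  pendant edge.\<close>

definition pc_index :: "nat \<Rightarrow> (nat \<Rightarrow> nat) \<Rightarrow> (nat \<times> nat) set" where
  "pc_index n w = Sigma {1..n} (\<lambda>i. {..w i})"

text \<open>The successor of \<open>i\<close> on the cycle \<open>1, \<dots>, n\<close> is \<open>i mod n + 1\<close>.\<close>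

definition pc_other :: "nat \<Rightarrow> nat \<times> nat \<Rightarrow> nat \<times> nat" where
  "pc_other n = (\<lambda>(i, j). if j = 0 then (i mod n + 1, 0) else (i, j))"

definition pc_edge :: "nat \<Rightarrow> nat \<times> nat \<Rightarrow> (nat \<times> nat) set" where
  "pc_edge n x = {(fst x, 0), pc_other n x}"

lemma verts_pendant_cycle: "verts (pendant_cycle n w) = pc_index n w"
  unfolding pendant_cycle_def pc_index_def by auto

lemma edges_pendant_cycle:
  assumes "n \<ge> 3"
  shows "edges (pendant_cycle n w) = pc_edge n ` pc_index n w"
proof
  show "edges (pendant_cycle n w) \<subseteq> pc_edge n ` pc_index n w"
  proof
    fix e assume "e \<in> edges (pendant_cycle n w)"
    then consider i where "1 \<le> i" "i < n" "e = {(i, 0), (i + 1, 0)}"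
      | "e = {(n, 0), (1, 0)}"
      | i j where "1 \<le> i" "i \<le> n" "1 \<le> j" "j \<le> w i" "e = {(i, 0), (i, j)}"
      unfolding pendant_cycle_def by auto
    then show "e \<in> pc_edge n ` pc_index n w"
    proof cases
      case 1 then show ?thesis
        by (intro image_eqI[of _ _ "(i, 0)"]) (auto simp: pc_edge_def pc_other_def pc_index_def)
    next
      case 2 then show ?thesis using assms
        by (intro image_eqI[of _ _ "(n, 0)"]) (auto simp: pc_edge_def pc_other_def pc_index_def)
    next
      case 3 then show ?thesis
        by (intro image_eqI[of _ _ "(i, j)"]) (auto simp: pc_edge_def pc_other_def pc_index_def)
    qed
  qed
  show "pc_edge n ` pc_index n w \<subseteq> edges (pendant_cycle n w)"
  proof safe
    fix i j assume "(i, j) \<in> pc_index n w"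
    then have ij: "1 \<le> i" "i \<le> n" "j \<le> w i" by (auto simp: pc_index_def)
    show "pc_edge n (i, j) \<in> edges (pendant_cycle n w)"
    proof (cases "j = 0")
      case True
      with ij show ?thesis
        by (cases "i = n") (auto simp: pendant_cycle_def pc_edge_def pc_other_def)
    next
      case False
      with ij show ?thesis
        by (auto simp: pendant_cycle_def pc_edge_def pc_other_def)
    qed
  qed
qed

lemma finite_pc_index: "finite (pc_index n w)"
  by (simp add: pc_index_def)

text \<open>No case analysis is needed: index set and edge set have equal cardinality.\<close>

lemma inj_on_pc_edge:
  assumes "n \<ge> 3"
  shows "inj_on (pc_edge n) (pc_index n w)"
proof (rule eq_card_imp_inj_on)
  have "card (pc_edge n ` pc_index n w) = (\<Sum>i=1..n. w i + 1)"
    using card_edges_pendant_cycle[OF assms, of w] edges_pendant_cycle[OF assms, of w] by simp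
  also have "\<dots> = card (pc_index n w)"
    using card_verts_pendant_cycle[of n w] verts_pendant_cycle[of n w] by simp
  finally show "card (pc_edge n ` pc_index n w) = card (pc_index n w)" .
qed (rule finite_pc_index)

lemma sum_pc_edge:
  fixes g :: "nat \<times> nat \<Rightarrow> nat"
  assumes "n \<ge> 3" and "x \<in> pc_index n w"
  shows "sum g (pc_edge n x) = g (fst x, 0) + g (pc_other n x)"
proof -
  obtain i j where x: "x = (i, j)" by force
  have "i mod n + 1 \<noteq> i"
    using assms by (cases "i = n") (auto simp: x pc_index_def)
  then have "(fst x, 0) \<noteq> pc_other n x"
    by (auto simp: x pc_other_def)
  then show ?thesis by (simp add: pc_edge_def)
qed

lemma bij_betw_cycle_succ:
  fixes n :: nat
  shows "bij_betw (\<lambda>i. i mod n + 1) {1..n} {1..n}"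
proof -
  have "inj_on (\<lambda>i. i mod n + 1) {1..n}"
  proof (rule inj_onI)
    fix i i' assume "i \<in> {1..n}" "i' \<in> {1..n}" "i mod n + 1 = i' mod n + 1"
    then show "i = i'" by (cases "i = n"; cases "i' = n") auto
  qed
  moreover have "(\<lambda>i. i mod n + 1) ` {1..n} \<subseteq> {1..n}"
    by (auto simp: Suc_le_eq)
  ultimately show ?thesis by (simp add: bij_betw_def endo_inj_surj)
qed

text \<open>Double counting by degrees: 1 for pendant vertices and \<open>w i + 2\<close> for
  \<open>(i, 0)\<close>. The ends \<open>pc_other\<close> of the edges run once through all
  vertices; the other ends give the second sum.\<close>

lemma sum_edge_sums_pendant_cycle:
  fixes g :: "nat \<times> nat \<Rightarrow> nat"
  assumes "n \<ge> 3"
  shows "(\<Sum>e\<in>edges (pendant_cycle n w). sum g e) =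
    (\<Sum>x\<in>verts (pendant_cycle n w). g x) + (\<Sum>i=1..n. (w i + 1) * g (i, 0))"
proof -
  have "(\<Sum>e\<in>edges (pendant_cycle n w). sum g e) = (\<Sum>x\<in>pc_index n w. sum g (pc_edge n x))"
    using inj_on_pc_edge[OF assms, of w] by (simp add: edges_pendant_cycle[OF assms] sum.reindex)
  also have "\<dots> = (\<Sum>x\<in>pc_index n w. g (fst x, 0) + g (pc_other n x))"
    using sum_pc_edge[OF assms] by (intro sum.cong) auto
  also have "\<dots> = (\<Sum>x\<in>pc_index n w. g (fst x, 0)) + (\<Sum>x\<in>pc_index n w. g (pc_other n x))"
    by (rule sum.distrib)
  also have "(\<Sum>x\<in>pc_index n w. g (fst x, 0)) = (\<Sum>i=1..n. (w i + 1) * g (i, 0))"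
    unfolding pc_index_def by (subst sum.Sigma[symmetric, unfolded split_def]) auto
  also have "(\<Sum>x\<in>pc_index n w. g (pc_other n x)) =
      (\<Sum>i=1..n. \<Sum>j\<le>w i. g (pc_other n (i, j)))"
    unfolding pc_index_def by (subst sum.Sigma) (auto simp: split_def)
  also have "\<dots> = (\<Sum>i=1..n. g (i mod n + 1, 0) + (\<Sum>j=1..w i. g (i, j)))"
    by (intro sum.cong refl)
      (simp add: atMost_atLeast0 sum.atLeast_Suc_atMost pc_other_def)
  also have "\<dots> = (\<Sum>i=1..n. g (i, 0)) + (\<Sum>i=1..n. \<Sum>j=1..w i. g (i, j))"
    unfolding sum.distrib
    using sum.reindex_bij_betw[OF bij_betw_cycle_succ, of "\<lambda>i. g (i, 0)" n] by simp
  also have "\<dots> = (\<Sum>i=1..n. \<Sum>j\<le>w i. g (i, j))"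
    unfolding sum.distrib[symmetric]
    by (intro sum.cong refl) (simp add: atMost_atLeast0 sum.atLeast_Suc_atMost)
  also have "\<dots> = (\<Sum>x\<in>verts (pendant_cycle n w). g x)"
    unfolding verts_pendant_cycle pc_index_def by (subst sum.Sigma) (auto simp: split_def)
  finally show ?thesis by simp
qed

section \<open>The lower bound\<close>

text \<open>Induction on the maximum, which is at least the cardinality.\<close>

lemma sum_positive_ge_triangular:
  fixes A :: "nat set"
  assumes "finite A" and "0 \<notin> A"
  shows "card A * (card A + 1) \<le> 2 * \<Sum>A"
  using assms
proof (induction A rule: finite_linorder_max_induct)
  case (insert b A)
  have "insert b A \<subseteq> {1..b}"
    using insert.hyps insert.prems by (force simp: Suc_le_eq intro: gr0I)
  then have "card (insert b A) \<le> card {1..b}" by (intro card_mono) auto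
  moreover have "b \<notin> A" using insert.hyps by auto
  ultimately show ?case using insert by (auto simp: algebra_simps)
qed simp

lemma sum_injective_positive_ge_triangular:
  fixes g :: "'a \<Rightarrow> nat"
  assumes "finite A" and "inj_on g A" and "\<And>x. x \<in> A \<Longrightarrow> g x > 0"
  shows "card A * (card A + 1) \<le> 2 * sum g A"
  using sum_positive_ge_triangular[of "g ` A"] assms
  by (force simp: card_image sum.reindex)

text \<open>The magic equation summed over the edges; the edge labels are all labels minus the
  vertex labels, which are moved to the left to avoid subtraction.\<close>

lemma semt_labeling_sum:
  assumes G: "simple_graph G" and f: "semt_labeling G f c"
  shows "card (edges G) * c + (\<Sum>v\<in>verts G. f (Inl v)) =
    (\<Sum>e\<in>edges G. \<Sum>v\<in>e. f (Inl v)) + \<Sum>{1..card (verts G) + card (edges G)}"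
proof -
  have fin: "finite (verts G)" using G by (simp add: simple_graph_def)
  have "edges G \<subseteq> Pow (verts G)" using G by (auto simp: simple_graph_def)
  with fin have finE: "finite (edges G)" by (meson finite_Pow_iff finite_subset)
  have magic: "(\<Sum>v\<in>e. f (Inl v)) + f (Inr e) = c" if e: "e \<in> edges G" for e
  proof -
    obtain u v where "e = {u, v}" "u \<noteq> v"
      using G e by (auto simp: simple_graph_def card_2_iff)
    then show ?thesis using f e by (simp add: semt_labeling_def)
  qed
  have "(\<Sum>{1..card (verts G) + card (edges G)}) = sum f (verts G <+> edges G)"
    using f sum.reindex_bij_betw[of f _ _ "\<lambda>x. x"] by (auto simp: semt_labeling_def)
  also have "\<dots> = (\<Sum>v\<in>verts G. f (Inl v)) + (\<Sum>e\<in>edges G. f (Inr e))"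
    using fin finE by (simp add: sum.Plus)
  finally have "(\<Sum>{1..card (verts G) + card (edges G)}) = \<dots>" .
  moreover have "card (edges G) * c = (\<Sum>e\<in>edges G. (\<Sum>v\<in>e. f (Inl v)) + f (Inr e))"
    using magic by simp
  ultimately show ?thesis by (simp add: sum.distrib)
qed

lemma G_graph_magic_constant_ge:
  assumes n: "n \<ge> 3" "odd n" and r: "odd r" "1 \<le> r" "r < n"
    and f: "semt_labeling (G_graph n k r) f c"
  shows "2 * n * (k + 1) + 4 + (n + 3) div 2 \<le> c"
proof -
  define w where "w = (\<lambda>i. if i = r \<or> i = n - r then k + 1 else k)"
  define p where "p = n * (k + 1) + 2"
  define x where "x = (\<lambda>i. f (Inl (i, 0::nat)))"
  have Gw: "G_graph n k r = pendant_cycle n w" by (simp add: G_graph_def w_def)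
  have G: "simple_graph (G_graph n k r)" unfolding Gw by (rule simple_graph_pendant_cycle[OF n(1)])
  note card = G_graph_order_size[OF n r, of k, folded p_def]
  have r2: "r \<noteq> n - r" using n r by presburger
  have bij: "bij_betw f (verts (G_graph n k r) <+> edges (G_graph n k r)) {1..2 * p}"
    using f card by (simp add: semt_labeling_def mult_2)
  have mem: "(i, 0) \<in> verts (G_graph n k r)" if "i \<in> {1..n}" for i
    using that by (simp add: Gw verts_pendant_cycle pc_index_def)
  have inj: "inj_on x {1..n}"
    using bij mem unfolding bij_betw_def inj_on_def x_def by blast
  have pos: "x i > 0" if "i \<in> {1..n}" for i
    using bij_betwE[OF bij] mem[OF that] by (force simp: x_def)
  have "n * (n + 1) \<le> 2 * sum x {1..n}"
    using sum_injective_positive_ge_triangular[OF _ inj] pos by simp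
  \<comment> \<open>The two additional pendant vertices count their neighbours once more; two
    distinct positive labels sum to at least \<open>1 + 2\<close>.\<close>
  moreover have "2 * 3 \<le> 2 * sum x {r, n - r}"
  proof -
    have sub: "{r, n - r} \<subseteq> {1..n}" using r by auto
    then have "card {r, n - r} * (card {r, n - r} + 1) \<le> 2 * sum x {r, n - r}"
      by (intro sum_injective_positive_ge_triangular inj_on_subset[OF inj] pos) auto
    then show ?thesis using r2 by simp
  qed
  moreover have "(\<Sum>i=1..n. (w i + 1) * x i) = (k + 1) * sum x {1..n} + sum x {r, n - r}"
  proof -
    have "(\<Sum>i=1..n. (w i + 1) * x i) =
        (\<Sum>i=1..n. (k + 1) * x i + (if i \<in> {r, n - r} then x i else 0))"
      by (intro sum.cong) (auto simp: w_def)
    also have "\<dots> = (k + 1) * sum x {1..n} + sum x ({1..n} \<inter> {r, n - r})"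
      unfolding sum.distrib by (simp only: sum.inter_restrict finite_atLeastAtMost sum_distrib_left)
    also have "{1..n} \<inter> {r, n - r} = {r, n - r}" using r by auto
    finally show ?thesis .
  qed
  moreover have "p * c = (\<Sum>i=1..n. (w i + 1) * x i) + \<Sum>{1..2 * p}"
    using semt_labeling_sum[OF G f] sum_edge_sums_pendant_cycle[OF n(1), of "\<lambda>v. f (Inl v)" w] card
    by (simp add: Gw x_def mult_2)
  moreover have "(\<Sum>{1..2 * p}) = p * (2 * p + 1)"
    using gauss_sum_from_Suc_0[where ?'a = nat, of "2 * p"] by simp
  moreover have "(k + 1) * (n * (n + 1)) \<le> (k + 1) * (2 * sum x {1..n})"
    using \<open>n * (n + 1) \<le> 2 * sum x {1..n}\<close> by (rule mult_le_mono2)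
  ultimately have "(k + 1) * (n * (n + 1)) + 6 + 2 * (p * (2 * p + 1)) \<le> 2 * (p * c)"
    by (simp add: algebra_simps)
  moreover obtain m where m: "n = 2 * m + 1" using n(2) by (elim oddE)
  moreover have "(k + 1) * (n * (n + 1)) + 2 * n + 2 = p * (n + 1)"
    by (simp add: p_def algebra_simps)
  ultimately have "p * (2 * m + 2) + 6 + 2 * (p * (2 * p + 1)) \<le> 2 * (p * c) + 4 * m + 4"
    by simp
  \<comment> \<open>So far only \<open>c >= 2 p + m + 2 - (2 m - 1) / p\<close> is known. Since
    \<open>2 m - 1 < p\<close>, integrality of \<open>c\<close> absorbs the fraction.\<close>
  moreover have "2 * m < p + 1" by (simp add: p_def m algebra_simps)
  ultimately have "p * (2 * p + m + 2) < p * (c + 1)"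
    by (simp add: algebra_simps)
  then have "2 * p + m + 2 < c + 1" by (rule mult_less_cancel1[THEN iffD1, THEN conjunct2])
  then show ?thesis by (simp add: p_def m algebra_simps)
qed

section \<open>The labeling\<close>

text \<open>\<open>arrange n k A B g j\<close> is the position of the \<open>j\<close>-th pendant vertex at the cycle vertex
  labeled \<open>g\<close>: the pendant vertices \<open>j = 1\<close> and \<open>j = k + 1\<close> share a block of length \<open>n + 2\<close>, and each
  \<open>j\<close> with \<open>2 \<le> j \<le> k\<close> has a block of length \<open>n\<close> of its own.\<close>

definition arrange :: "nat \<Rightarrow> nat \<Rightarrow> (bool \<Rightarrow> nat \<Rightarrow> nat) \<Rightarrow> (nat \<Rightarrow> nat) \<Rightarrow> nat \<Rightarrow> nat \<Rightarrow> nat" where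
  "arrange n k A B g j =
     (if j = 1 \<or> j = k + 1 then A (j \<noteq> 1) g else n + 2 + ((j - 2) * n + B g))"

lemma mult_add_less_inject:
  fixes n b b' i i' :: nat
  assumes "i * n + b = i' * n + b'" and "b < n" and "b' < n"
  shows "i = i' \<and> b = b'"
proof -
  have "(i * n + b) div n = i" "(i' * n + b') div n = i'" using assms(2,3) by auto
  then have "i = i'" using assms(1) by metis
  with assms(1) show ?thesis by simp
qed

lemma arrange_less:
  assumes A: "\<And>e. A e g < n + 2" and B: "B g < n"
    and j: "1 \<le> j" "j \<le> k + 1" "k \<ge> 1"
  shows "arrange n k A B g j < n * k + 2"
proof (cases "j = 1 \<or> j = k + 1")
  case True
  have "n + 2 \<le> n * k + 2" using j by simp
  with A[of "j \<noteq> 1"] have "A (j \<noteq> 1) g < n * k + 2" by (rule less_le_trans)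
  with True show ?thesis by (simp add: arrange_def)
next
  case False
  with j have "2 \<le> j" by linarith
  then obtain i where i: "j = i + 2" by (metis le_add_diff_inverse2)
  then have "(i + 2) * n \<le> k * n" using False j by (intro mult_le_mono1) simp
  with False B i show ?thesis by (simp add: arrange_def algebra_simps)
qed

text \<open>Arbitrary \<open>A\<close> and \<open>B\<close> let one argument serve both the pendant
  labels and the pendant edge sums. Values below \<open>n + 2\<close> belong to the long block;
  beyond it, division by \<open>n\<close> recovers \<open>j\<close>.\<close>

lemma arrange_inject:
  assumes A: "\<And>e. A e g < n + 2" "\<And>e. A e g' < n + 2"
    and A_inj: "j = 1 \<or> j = k + 1 \<Longrightarrow> j' = 1 \<or> j' = k + 1 \<Longrightarrow> A (j \<noteq> 1) g = A (j' \<noteq> 1) g' \<Longrightarrow> g = g' \<and> (j \<noteq> 1) = (j' \<noteq> 1)"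
    and B: "B g < n" "B g' < n" and B_inj: "B g = B g' \<Longrightarrow> g = g'"
    and j: "1 \<le> j" "1 \<le> j'"
    and eq: "arrange n k A B g j = arrange n k A B g' j'"
  shows "g = g' \<and> j = j'"
proof -
  consider "j = 1 \<or> j = k + 1" "j' = 1 \<or> j' = k + 1"
    | "j = 1 \<or> j = k + 1" "\<not> (j' = 1 \<or> j' = k + 1)"
    | "\<not> (j = 1 \<or> j = k + 1)" "j' = 1 \<or> j' = k + 1"
    | "\<not> (j = 1 \<or> j = k + 1)" "\<not> (j' = 1 \<or> j' = k + 1)"
    by blast
  then show ?thesis
  proof cases
    case 1
    then have "A (j \<noteq> 1) g = A (j' \<noteq> 1) g'"
      using eq by (simp only: arrange_def if_True)
    with A_inj 1 have "g = g'" "(j \<noteq> 1) = (j' \<noteq> 1)" by simp_all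
    with 1 show ?thesis by auto
  next
    case 2
    then show ?thesis using eq A(1)[of "j \<noteq> 1"] by (simp add: arrange_def)
  next
    case 3
    then show ?thesis using eq A(2)[of "j' \<noteq> 1"] by (simp add: arrange_def)
  next
    case 4
    then have "(j - 2) * n + B g = (j' - 2) * n + B g'"
      using eq by (simp add: arrange_def)
    from mult_add_less_inject[OF this B] have "j - 2 = j' - 2" "B g = B g'" by auto
    with 4 B_inj j show ?thesis by auto
  qed
qed

text \<open>In the functions below the displacement is \<open>\<delta> = g - (m + 1)\<close>. The flag \<open>e\<close> marks the two
  additional pendant vertices, which occur only at the labels \<open>x\<close> and \<open>2 m + 2 - x\<close>, and
  \<open>d = m + 1 - x\<close>.\<close>

definition long_source :: "nat \<Rightarrow> nat \<Rightarrow> bool \<Rightarrow> nat \<Rightarrow> nat" where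
  "long_source m x e g =
     (if e then if g \<le> m then m + 2 - x else m + 3 - x
      else if g \<le> m then g + m + 2
      else if g \<le> 2 * m + 2 - x then g - (m + 1) else g + 1 - m)"

definition long_target :: "nat \<Rightarrow> nat \<Rightarrow> bool \<Rightarrow> nat \<Rightarrow> nat" where
  "long_target m x e g =
     (if e then if g \<le> m then 1 else 2 * (m + 2 - x)
      else if g \<le> m then 2 * g + 1
      else if g \<le> 2 * m + 2 - x then 2 * (g - (m + 1)) else 2 * (g - m))"

text \<open>The unique \<open>t\<close> in \<open>0..2 m\<close> for which
  \<open>2 t mod (2 m + 1)\<close> has displacement \<open>g - (m + 1)\<close> from
  \<open>t\<close>; \<open>short_target\<close> is that image.\<close>

definition short_source :: "nat \<Rightarrow> nat \<Rightarrow> nat" where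
  "short_source m g = (if g \<le> m then g + m else g - (m + 1))"

definition short_target :: "nat \<Rightarrow> nat \<Rightarrow> nat" where
  "short_target m g = (if g \<le> m then 2 * (g - 1) + 1 else 2 * (g - (m + 1)))"

lemma short_less:
  assumes "1 \<le> g" "g \<le> 2 * m + 1"
  shows "short_source m g < 2 * m + 1" and "short_target m g < 2 * m + 1"
  using assms by (auto simp: short_source_def short_target_def)

lemma short_inject:
  assumes "1 \<le> g" "g \<le> 2 * m + 1" "1 \<le> g'" "g' \<le> 2 * m + 1"
  shows "short_source m g = short_source m g' \<Longrightarrow> g = g'"
    and "short_target m g = short_target m g' \<Longrightarrow> g = g'"
  using assms by (simp_all add: short_source_def short_target_def split: if_splits; presburger)+

context
  fixes m x :: nat
  assumes x: "1 \<le> x" "x \<le> m"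
begin

lemma long_less:
  assumes "1 \<le> g" "g \<le> 2 * m + 1"
  shows "long_source m x e g < 2 * m + 1 + 2" and "long_target m x e g < 2 * m + 1 + 2"
  using assms x by (auto simp: long_source_def long_target_def)

lemma long_inject:
  assumes "1 \<le> g" "g \<le> 2 * m + 1" "1 \<le> g'" "g' \<le> 2 * m + 1"
    and "e \<Longrightarrow> g = x \<or> g = 2 * m + 2 - x" and "e' \<Longrightarrow> g' = x \<or> g' = 2 * m + 2 - x"
  shows "long_source m x e g = long_source m x e' g' \<Longrightarrow> g = g' \<and> e = e'"
    and "long_target m x e g = long_target m x e' g' \<Longrightarrow> g = g' \<and> e = e'"
proof -
  show "g = g' \<and> e = e'" if "long_source m x e g = long_source m x e' g'"
    using that assms x by (cases e; cases e') (auto simp: long_source_def split: if_splits)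
  show "g = g' \<and> e = e'" if eq: "long_target m x e g = long_target m x e' g'"
  proof -
    \<comment> \<open>Parity separates negative displacements from the others: the odd targets are
      \<open>1\<close> for the flagged vertex and \<open>3, 5, ...\<close> for the rest.\<close>
    have "odd (long_target m x e g) \<longleftrightarrow> g \<le> m" for e g
      by (simp add: long_target_def)
    with eq have "g \<le> m \<longleftrightarrow> g' \<le> m" by metis
    then consider "g \<le> m" "g' \<le> m" | "m < g" "m < g'" by linarith
    then show ?thesis
    proof cases
      case 1
      with eq assms x show ?thesis
        by (cases e; cases e') (auto simp: long_target_def)
    next
      case 2
      with eq assms x show ?thesis
        by (cases e; cases e') (simp_all add: long_target_def split: if_splits)
    qed
  qed
qed

text \<open>Turns pendant edge sums into targets. Source and target lie in the same block, so its
  offset cancels.\<close>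

lemma arrange_displacement:
  assumes "1 \<le> g" "g \<le> 2 * m + 1" "j = k + 1 \<Longrightarrow> j \<noteq> 1 \<Longrightarrow> g = x \<or> g = 2 * m + 2 - x"
  shows "g + arrange (2 * m + 1) k (long_source m x) (short_source m) g j =
    m + 1 + arrange (2 * m + 1) k (long_target m x) (short_target m) g j"
proof -
  have "g + short_source m g = m + 1 + short_target m g"
    using assms by (auto simp: short_source_def short_target_def)
  moreover have "g + long_source m x e g = m + 1 + long_target m x e g"
    if "e \<Longrightarrow> g = x \<or> g = 2 * m + 2 - x" for e
    using assms x that by (cases e) (auto simp: long_source_def long_target_def)
  ultimately show ?thesis using assms(3) by (simp add: arrange_def)
qed

end

section \<open>Labels of the cycle vertices\<close>

text \<open>Around the cycle the labels read
  \<open>1, m + 2, 2, m + 3, ..., 2 m + 1, m + 1\<close>.\<close>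

definition cycle_label :: "nat \<Rightarrow> nat \<Rightarrow> nat" where
  "cycle_label m i = (if odd i then (i + 1) div 2 else m + 1 + i div 2)"

lemma cycle_label_bounds:
  assumes "1 \<le> i" "i \<le> 2 * m + 1"
  shows "1 \<le> cycle_label m i" and "cycle_label m i \<le> 2 * m + 1"
  using assms by (auto simp: cycle_label_def elim!: oddE evenE)

lemma cycle_label_inject:
  assumes "1 \<le> i" "i \<le> 2 * m + 1" "1 \<le> i'" "i' \<le> 2 * m + 1"
    and "cycle_label m i = cycle_label m i'"
  shows "i = i'"
  using assms by (auto simp: cycle_label_def elim!: oddE evenE split: if_splits)

text \<open>The closing edge \<open>i = 2 m + 1\<close> has the smallest sum, \<open>m + 2\<close>;
  the others continue upwards to \<open>3 m + 2\<close>.\<close>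

lemma cycle_label_edge_sum:
  assumes "1 \<le> i" "i \<le> 2 * m + 1"
  shows "cycle_label m i + cycle_label m (i mod (2 * m + 1) + 1) = m + 2 + i mod (2 * m + 1)"
proof (cases "i = 2 * m + 1")
  case False
  then show ?thesis using assms by (auto simp: cycle_label_def elim!: oddE evenE)
qed (simp add: cycle_label_def)

section \<open>Combining cycle and pendant vertices\<close>

text \<open>The threshold \<open>N\<close> separates cycle from pendant values; applied to the
  vertex labels and again to the edge sums.\<close>

lemma inj_on_pc_index:
  fixes u :: "nat \<Rightarrow> nat" and v :: "nat \<Rightarrow> nat \<Rightarrow> nat"
  assumes "inj_on u {1..n}" and "\<And>i. i \<in> {1..n} \<Longrightarrow> u i < N"
    and "inj_on (\<lambda>(i, j). v i j) {(i, j) \<in> pc_index n w. j \<ge> 1}"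
    and "\<And>i j. (i, j) \<in> pc_index n w \<Longrightarrow> j \<ge> 1 \<Longrightarrow> N \<le> v i j"
  shows "inj_on (\<lambda>(i, j). if j = 0 then u i else v i j) (pc_index n w)"
proof (rule inj_onI; clarify)
  fix i j i' j'
  assume ij: "(i, j) \<in> pc_index n w" "(i', j') \<in> pc_index n w"
    and eq: "(if j = 0 then u i else v i j) = (if j' = 0 then u i' else v i' j')"
  have i: "i \<in> {1..n}" "i' \<in> {1..n}" using ij by (auto simp: pc_index_def)
  consider "j = 0" "j' = 0" | "j = 0" "j' \<ge> 1" | "j \<ge> 1" "j' = 0" | "j \<ge> 1" "j' \<ge> 1"
    by linarith
  then show "i = i' \<and> j = j'"
  proof cases
    case 1 with eq i assms(1) show ?thesis by (auto dest: inj_onD)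
  next
    case 2 with eq assms(2)[OF i(1)] assms(4)[OF ij(2)] show ?thesis by simp
  next
    case 3 with eq assms(2)[OF i(2)] assms(4)[OF ij(1)] show ?thesis by simp
  next
    case 4 with eq ij inj_onD[OF assms(3), of "(i, j)" "(i', j')"] show ?thesis by simp
  qed
qed

lemma G_graph_semt_labeling:
  assumes n: "n \<ge> 3" "odd n" and k: "k \<ge> 1" and r: "odd r" "1 \<le> r" "r < n"
  shows "\<exists>f. semt_labeling (G_graph n k r) f (2 * n * (k + 1) + 4 + (n + 3) div 2)"
proof -
  obtain m where m: "n = 2 * m + 1" using n(2) by (elim oddE)
  obtain y where y: "r = 2 * y + 1" using r(1) by (elim oddE)
  define x where "x = y + 1"
  define w where "w = (\<lambda>i. if i = r \<or> i = n - r then k + 1 else k)"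
  define c where "c = cycle_label m"
  define S where "S = arrange n k (long_source m x) (short_source m)"
  define T where "T = arrange n k (long_target m x) (short_target m)"
  \<comment> \<open>Positions in \<open>S\<close> start at 0 and the cycle uses \<open>1..n\<close>,
    hence the offset \<open>n + 1\<close>.\<close>
  define v where "v = (\<lambda>(i, j). if j = 0 then c i else n + 1 + S (c i) j)"
  have Gw: "G_graph n k r = pendant_cycle n w" by (simp add: G_graph_def w_def)
  have G: "simple_graph (G_graph n k r)" unfolding Gw by (rule simple_graph_pendant_cycle[OF n(1)])
  note card = G_graph_order_size[OF n r, of k]
  have x: "1 \<le> x" "x \<le> m" using r m y by (auto simp: x_def)
  have c: "1 \<le> c i" "c i \<le> 2 * m + 1" if "i \<in> {1..n}" for i
    using that cycle_label_bounds[of i m] by (auto simp: c_def m)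
  have inj_c: "i = i'" if "i \<in> {1..n}" "i' \<in> {1..n}" "c i = c i'" for i i'
    using that cycle_label_inject[of i m i'] by (auto simp: c_def m)
  \<comment> \<open>As \<open>r\<close> is odd and \<open>n - r\<close> even, their labels are
    symmetric about \<open>m + 1\<close>, so the additional displacements are opposite.\<close>
  have c_extra: "c r = x" "c (n - r) = 2 * m + 2 - x"
    using r by (auto simp: c_def cycle_label_def x_def m y)
  have j: "i \<in> {1..n} \<and> j \<le> k + 1" if "(i, j) \<in> pc_index n w" for i j
    using that by (auto simp: pc_index_def w_def split: if_splits)
  have extra: "c i = x \<or> c i = 2 * m + 2 - x" if "(i, k + 1) \<in> pc_index n w" for i
    using that c_extra by (auto simp: pc_index_def w_def split: if_splits)
  have less: "S (c i) j < n * k + 2" "T (c i) j < n * k + 2"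
    if "(i, j) \<in> pc_index n w" "j \<ge> 1" for i j
  proof -
    have i: "i \<in> {1..n}" "j \<le> k + 1" using j[OF that(1)] by simp_all
    show "S (c i) j < n * k + 2" "T (c i) j < n * k + 2"
      unfolding S_def T_def m
      by (rule arrange_less long_less[OF x c[OF i(1)]] short_less[OF c[OF i(1)]] that(2) i(2) k)+
  qed
  have inject: "i = i' \<and> j = j'"
    if ij: "(i, j) \<in> pc_index n w" "(i', j') \<in> pc_index n w" "j \<ge> 1" "j' \<ge> 1"
      and eq: "S (c i) j = S (c i') j' \<or> T (c i) j = T (c i') j'" for i j i' j'
  proof -
    have i: "i \<in> {1..n}" "i' \<in> {1..n}" using j ij by blast+
    note b = c[OF i(1)] c[OF i(2)]
    have long: "c i = c i' \<and> (j \<noteq> 1) = (j' \<noteq> 1)"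
      if "j = 1 \<or> j = k + 1" "j' = 1 \<or> j' = k + 1"
        and "long_source m x (j \<noteq> 1) (c i) = long_source m x (j' \<noteq> 1) (c i') \<or>
          long_target m x (j \<noteq> 1) (c i) = long_target m x (j' \<noteq> 1) (c i')"
    proof -
      have "j \<noteq> 1 \<Longrightarrow> c i = x \<or> c i = 2 * m + 2 - x"
        "j' \<noteq> 1 \<Longrightarrow> c i' = x \<or> c i' = 2 * m + 2 - x"
        using extra ij that by auto
      from long_inject[OF x b this] that(3) show ?thesis by blast
    qed
    note less = long_less[OF x b(1,2)] long_less[OF x b(3,4)]
      short_less[OF b(1,2)] short_less[OF b(3,4)]
    have "c i = c i' \<and> j = j'"
      using eq
    proof
      assume "S (c i) j = S (c i') j'"
      then show ?thesis
        unfolding S_def m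
        by (rule arrange_inject[OF _ _ _ _ _ _ ij(3,4), rotated -1])
          (assumption | rule less long short_inject(1)[OF b] disjI1)+
    next
      assume "T (c i) j = T (c i') j'"
      then show ?thesis
        unfolding T_def m
        by (rule arrange_inject[OF _ _ _ _ _ _ ij(3,4), rotated -1])
          (assumption | rule less long short_inject(2)[OF b] disjI2)+
    qed
    with inj_c[OF i] show ?thesis by simp
  qed
  have inj: "inj_on (\<lambda>(i, j). q + S (c i) j) {(i, j) \<in> pc_index n w. j \<ge> 1}"
    "inj_on (\<lambda>(i, j). q + T (c i) j) {(i, j) \<in> pc_index n w. j \<ge> 1}" for q
    using inject by (auto simp: inj_on_def)
  have "inj_on v (pc_index n w)"
    unfolding v_def
  proof (rule inj_on_pc_index[where N = "n + 1"])
    show "inj_on c {1..n}" using inj_c by (auto intro: inj_onI)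
    show "c i < n + 1" if "i \<in> {1..n}" for i using c[OF that] m by simp
  qed (rule inj(1), simp)
  moreover have "v ` pc_index n w \<subseteq> {1..n * (k + 1) + 2}"
  proof safe
    fix i j assume ij: "(i, j) \<in> pc_index n w"
    show "v (i, j) \<in> {1..n * (k + 1) + 2}"
      using c[of i] less(1)[OF ij] j[OF ij] by (cases "j = 0") (auto simp: v_def m)
  qed
  ultimately have bij: "bij_betw v (verts (G_graph n k r)) {1..card (verts (G_graph n k r))}"
    using card(1) unfolding bij_betw_def
    by (simp add: Gw verts_pendant_cycle card_image card_subset_eq)
  have v_edge: "sum v (pc_edge n (i, j)) =
      (if j = 0 then m + 2 + i mod n else n + 1 + (m + 1) + T (c i) j)"
    if ij: "(i, j) \<in> pc_index n w" for i j
  proof (cases "j = 0")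
    case True
    then show ?thesis
      using j[OF ij] cycle_label_edge_sum[of i m] sum_pc_edge[OF n(1) ij, of v]
      by (simp add: v_def c_def pc_other_def m)
  next
    case False
    have "c i + S (c i) j = m + 1 + T (c i) j"
      unfolding S_def T_def m using c[of i] j[OF ij] extra[of i] ij
      by (intro arrange_displacement[OF x]) auto
    with False show ?thesis using sum_pc_edge[OF n(1) ij, of v] by (simp add: v_def pc_other_def)
  qed
  have "inj_on (\<lambda>(i, j). if j = 0 then m + 2 + i mod n else n + 1 + (m + 1) + T (c i) j)
      (pc_index n w)"
  \<comment> \<open>The threshold is \<open>3 m + 3\<close>, one more than the largest cycle
    sum.\<close>
  proof (rule inj_on_pc_index[where N = "n + 1 + (m + 1)"])
    show "inj_on (\<lambda>i. m + 2 + i mod n) {1..n}"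
    proof (rule inj_onI)
      fix i i' assume "i \<in> {1..n}" "i' \<in> {1..n}" "m + 2 + i mod n = m + 2 + i' mod n"
      then show "i = i'"
        using inj_onD[OF bij_betw_imp_inj_on[OF bij_betw_cycle_succ[of n]], of i i'] by simp
    qed
    show "m + 2 + i mod n < n + 1 + (m + 1)" for i using n(1) by simp
  qed (rule inj(2), simp)
  also have "?this \<longleftrightarrow> inj_on (sum v \<circ> pc_edge n) (pc_index n w)"
    using v_edge by (intro inj_on_cong) (auto split: prod.splits)
  finally have "inj_on (sum v) (edges (G_graph n k r))"
    by (simp add: Gw edges_pendant_cycle[OF n(1)] inj_on_imageI)
  moreover have "sum v ` edges (G_graph n k r) \<subseteq> {m + 2..<m + 2 + card (edges (G_graph n k r))}"
  proof -
    have "sum v (pc_edge n (i, j)) \<in> {m + 2..<m + 2 + (n * (k + 1) + 2)}"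
      if ij: "(i, j) \<in> pc_index n w" for i j
    proof (cases "j = 0")
      case True
      have "i mod n < n" using n(1) by simp
      then have "i mod n < n * (k + 1) + 2" by (simp add: trans_less_add1)
      with True show ?thesis using v_edge[OF ij] by simp
    next
      case False
      then show ?thesis using less(2)[OF ij] v_edge[OF ij] by (simp add: m)
    qed
    then show ?thesis unfolding card(2) by (auto simp: Gw edges_pendant_cycle[OF n(1)])
  qed
  ultimately have "\<exists>f. semt_labeling (G_graph n k r) f
      (card (verts (G_graph n k r)) + card (edges (G_graph n k r)) + (m + 2))"
    by (rule semt_labeling_of_vertex_labeling[OF G bij])
  moreover have "n * (k + 1) + 2 + (n * (k + 1) + 2) + (m + 2) = 2 * n * (k + 1) + 4 + (n + 3) div 2"
    by (simp add: m)
  ultimately show ?thesis by (simp only: card)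
qed

theorem theorem4p1:
  fixes n k r :: nat
  assumes "n \<ge> 3" and "odd n" and "k \<ge> 1" and "odd r" and "1 \<le> r" and "r < n"
  shows "super_edge_magic_total (G_graph n k r) \<and>
    semt_strength (G_graph n k r) = 2 * n * (k + 1) + 4 + (n + 3) div 2"
proof
  have ex: "\<exists>f. semt_labeling (G_graph n k r) f (2 * n * (k + 1) + 4 + (n + 3) div 2)"
    using assms by (rule G_graph_semt_labeling)
  then show "super_edge_magic_total (G_graph n k r)"
    unfolding super_edge_magic_total_def by blast
  show "semt_strength (G_graph n k r) = 2 * n * (k + 1) + 4 + (n + 3) div 2"
    unfolding semt_strength_def
  proof (rule Least_equality)
    show "\<exists>f. semt_labeling (G_graph n k r) f (2 * n * (k + 1) + 4 + (n + 3) div 2)" by (rule ex)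
  next
    fix c assume "\<exists>f. semt_labeling (G_graph n k r) f c"
    then show "2 * n * (k + 1) + 4 + (n + 3) div 2 \<le> c"
      using G_graph_magic_constant_ge[OF assms(1,2,4-6)] by blast
  qed
qed

end
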